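(* Let $\mathcal G$ be a directed tree with $h(\mathcal G)>0$, where $h(\mathcal G)$ is the length of the longest directed path in $\mathcal G$, and let $$\hat{\mathcal E}_{\mathcal G}=\{[h]^w : 0\le h\le h(\mathcal G),\ 0\le w\le w_{\mathcal G}(h)\}.$$ Then the poset $P_{\mathcal G}$ has ground set $$\mathcal E_{\mathcal G}=\{0\}\cup\hat{\mathcal E}_{\mathcal G}\cup\{[i]^w : 0\le i\le h,\ [h]^w\in\hat{\mathcal E}_{\mathcal G}\},$$ and its covering relations are exactly the following: $$\{0\prec[0]^w : [0]^w\in P_{\mathcal G}\},\qquad \{[h-1]^w\prec[h]^w : [h]^w\in P_{\mathcal G},\ h\ge 1\},$$ $$\{[h-i]^{w+2i}\prec[h]^w : [h-i]^{w+2i},[h]^w\in P_{\mathcal G}\text{ with } i>0 \text{ minimal}\}.$$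
   Context: A directed tree $\mathcal G=([m],E)$ is a directed acyclic graph on $[m]=\{1,\dots,m\}$ whose underlying undirected graph is a tree and which has a unique source node (root) $r$. The height of a vertex $v$ is the length of the unique directed path from $r$ to $v$. A trek between $i$ and $j$ is a pair $T=\{P,Q\}$ of directed paths (length zero allowed) with a common starting node $\mathrm{top}(T)$, $P$ ending at $i$ and $Q$ ending at $j$; its length is $|T|=|P|+|Q|$ (number of edges). It is simple if $\mathrm{top}(T)$ is the only node common to $P$ and $Q$. For $0\le h\le h(\mathcal G)$, $w_{\mathcal G}(h)$ is the maximum length of a simple trek whose top node has height $h$. Let $N$ be the length of the longest trek in $\mathcal G$. For $i,j\in[m]$ let $t(i,j)\in\mathbb Z_{\ge0}^{\{0,1,\dots,N\}}$ be the vector whose $k$-th entry is the number of treks between $i$ and $j$ of length $k$ (the coefficient vector of the trek polynomial $\sum_{T}\omega\lambda^{|T|}$, the sum over all treks between $i$ and $j$). The poset $P_{\mathcal G}$ (written $P_{\varphi_{\mathcal G,c^*}}$ in the literature, $c^*$ the constant coloring) has as ground set all coordinatewise minima $\bigwedge_{(i,j)\in S}t(i,j)$ over nonempty $S\subseteq\{(i,j):1\le i\le j\le m\}$, ordered by the coordinatewise order $\preceq$. For integers $h,w\ge0$, $[h]^w$ denotes the $0/1$ vector with ones exactly in positions $w,w+2,\dots,w+2h$ (the coefficient vector of $\lambda^w(1+\lambda^2+\cdots+\lambda^{2h})$). *)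

theory Defs
  imports "Graph_Theory.Graph_Theory"
begin

(* The constant tree of Digraph_Component is not used: applied to a digraph it only
   excludes directed cycles, and applied to a symmetrisation it counts u -> v -> u as a
   cycle.  Undirected cycles are therefore those of length at least 3 in mk_symmetric G. *)
definition undirected_tree :: "nat pair_pre_digraph \<Rightarrow> bool" where
  "undirected_tree G \<longleftrightarrow>
     Digraph_Component.connected (with_proj G) \<and>
     \<not> (\<exists>p. pre_digraph.cycle (with_proj (mk_symmetric (with_proj G))) p \<and> 3 \<le> length p)"

definition source :: "nat pair_pre_digraph \<Rightarrow> nat \<Rightarrow> bool" where
  "source G r \<longleftrightarrow> r \<in> pverts G \<and> (\<forall>u. (u, r) \<notin> parcs G)"

definition directed_tree :: "nat pair_pre_digraph \<Rightarrow> bool" where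
  "directed_tree G \<longleftrightarrow>
     pair_fin_digraph G \<and> acyclic (parcs G) \<and> undirected_tree G \<and> (\<exists>!r. source G r)"

definition root :: "nat pair_pre_digraph \<Rightarrow> nat" where
  "root G = (THE r. source G r)"

(* Directed paths are the vpaths of Vertex_Walk: nonempty lists of distinct vertices;
   vwalk_length counts edges. *)
abbreviation dipath :: "nat pair_pre_digraph \<Rightarrow> nat list \<Rightarrow> bool" where
  "dipath G p \<equiv> vpath p (with_proj G)"

definition vertex_height :: "nat pair_pre_digraph \<Rightarrow> nat \<Rightarrow> nat" where
  "vertex_height G v = vwalk_length (THE p. dipath G p \<and> hd p = root G \<and> last p = v)"

definition graph_height :: "nat pair_pre_digraph \<Rightarrow> nat" where
  "graph_height G = Max {vwalk_length p | p. dipath G p}"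

(* A trek between i and j is the pair (P, Q) with P ending at i and Q ending at j.  For
   i = j in a directed tree necessarily P = Q, so ordered and unordered pairs give the
   same count of treks between i and j. *)
type_synonym trek = "nat list \<times> nat list"

definition is_trek :: "nat pair_pre_digraph \<Rightarrow> trek \<Rightarrow> bool" where
  "is_trek G T \<longleftrightarrow> dipath G (fst T) \<and> dipath G (snd T) \<and> hd (fst T) = hd (snd T)"

definition trek_top :: "trek \<Rightarrow> nat" where
  "trek_top T = hd (fst T)"

definition trek_length :: "trek \<Rightarrow> nat" where
  "trek_length T = vwalk_length (fst T) + vwalk_length (snd T)"

definition simple_trek :: "nat pair_pre_digraph \<Rightarrow> trek \<Rightarrow> bool" where
  "simple_trek G T \<longleftrightarrow> is_trek G T \<and> set (fst T) \<inter> set (snd T) = {trek_top T}"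

definition treks_between :: "nat pair_pre_digraph \<Rightarrow> nat \<Rightarrow> nat \<Rightarrow> trek set" where
  "treks_between G i j = {T. is_trek G T \<and> last (fst T) = i \<and> last (snd T) = j}"

definition trek_width :: "nat pair_pre_digraph \<Rightarrow> nat \<Rightarrow> nat" where
  "trek_width G h =
     Max {trek_length T | T. simple_trek G T \<and> vertex_height G (trek_top T) = h}"

definition max_trek_length :: "nat pair_pre_digraph \<Rightarrow> nat" where
  "max_trek_length G = Max {trek_length T | T. is_trek G T}"

(* Vectors indexed by {0..N}, N = max_trek_length G, are functions on nat that vanish
   beyond N; the coordinatewise order is then the pointwise order on functions. *)
type_synonym coeff_vec = "nat \<Rightarrow> nat"

definition trek_vec :: "nat pair_pre_digraph \<Rightarrow> nat \<Rightarrow> nat \<Rightarrow> coeff_vec" where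
  "trek_vec G i j = (\<lambda>k. if k \<le> max_trek_length G
     then card {T \<in> treks_between G i j. trek_length T = k} else 0)"

definition coordinatewise_min :: "coeff_vec set \<Rightarrow> coeff_vec" where
  "coordinatewise_min X = (\<lambda>k. Min ((\<lambda>x. x k) ` X))"

definition vertex_pairs :: "nat pair_pre_digraph \<Rightarrow> (nat \<times> nat) set" where
  "vertex_pairs G = {(i, j). i \<in> pverts G \<and> j \<in> pverts G \<and> i \<le> j}"

definition poset_ground :: "nat pair_pre_digraph \<Rightarrow> coeff_vec set" where
  "poset_ground G =
     {coordinatewise_min ((\<lambda>(i, j). trek_vec G i j) ` S) | S. S \<subseteq> vertex_pairs G \<and> S \<noteq> {}}"

definition covering_relations :: "'a::order set \<Rightarrow> ('a \<times> 'a) set" where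
  "covering_relations A =
     {(x, y). x \<in> A \<and> y \<in> A \<and> x < y \<and> \<not> (\<exists>z \<in> A. x < z \<and> z < y)}"

(* ladder h w is the vector [h]^w. *)
definition ladder :: "nat \<Rightarrow> nat \<Rightarrow> coeff_vec" where
  "ladder h w = (\<lambda>k. if \<exists>i \<le> h. k = w + 2 * i then 1 else 0)"

definition E_hat :: "nat pair_pre_digraph \<Rightarrow> coeff_vec set" where
  "E_hat G = {ladder h w | h w. h \<le> graph_height G \<and> w \<le> trek_width G h}"

end

theory Submission
  imports Defs
begin

text \<open>
  Every path ending at \<open>v\<close> is a suffix of the unique path from the root to \<open>v\<close>.  Hence the treks
  between \<open>i\<close> and \<open>j\<close> arise from the simple one, of length \<open>w\<close> with top at height \<open>h\<close>, by moving
  the top upwards, each step adding 2 to the length; so \<open>t(i, j) = [h]\<^sup>w\<close>, and the vectors \<open>t(i, j)\<close>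
  are exactly those of \<open>E_hat\<close>.  The minimum of two ladders is 0 or a truncation of the one that starts
  higher.  Conversely all truncations occur because of the inequality
  \<open>2 (h - i) + w(h) \<le> 2 w(i)\<close> for \<open>i \<le> h\<close>.  The covering relations then follow by viewing ladders as
  intervals.
\<close>

section \<open>Ladders\<close>

lemma ladder_eq_0_iff: "ladder h w k = 0 \<longleftrightarrow> \<not> (\<exists>i\<le>h. k = w + 2 * i)"
  by (simp add: ladder_def)

text \<open>For 0/1 vectors the order is inclusion of supports. Progressions of step 2 are nested as
  soon as the lowest and the highest rung of the smaller one are rungs of the larger;
  \<open>d\<close> counts the rungs missing at the bottom.\<close>

lemma ladder_le_iff:
  "ladder h w \<le> ladder h' w' \<longleftrightarrow> (\<exists>d. w = w' + 2 * d \<and> h + d \<le> h')"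
proof
  assume le: "ladder h w \<le> ladder h' w'"
  have supp: "\<exists>j\<le>h'. w + 2 * i = w' + 2 * j" if "i \<le> h" for i
  proof -
    have "ladder h w (w + 2 * i) = 1"
      using that by (auto simp: ladder_def)
    with le have "ladder h' w' (w + 2 * i) \<noteq> 0"
      by (metis le_fun_def not_one_le_zero)
    then show ?thesis by (simp add: ladder_eq_0_iff)
  qed
  obtain d where d: "w = w' + 2 * d" using supp[of 0] by auto
  obtain j where "j \<le> h'" "w + 2 * h = w' + 2 * j" using supp[of h] by auto
  with d show "\<exists>d. w = w' + 2 * d \<and> h + d \<le> h'" by (intro exI[of _ d]) auto
next
  assume "\<exists>d. w = w' + 2 * d \<and> h + d \<le> h'"
  then obtain d where d: "w = w' + 2 * d" "h + d \<le> h'" by blast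
  have "\<exists>j\<le>h'. w + 2 * i = w' + 2 * j" if "i \<le> h" for i
    using d that by (intro exI[of _ "d + i"]) auto
  then show "ladder h w \<le> ladder h' w'"
    by (auto simp: le_fun_def ladder_def)
qed

lemma ladder_eq_iff: "ladder h w = ladder h' w' \<longleftrightarrow> h = h' \<and> w = w'"
proof
  assume eq: "ladder h w = ladder h' w'"
  then have "ladder h w \<le> ladder h' w'" "ladder h' w' \<le> ladder h w" by simp_all
  then show "h = h' \<and> w = w'" by (auto simp: ladder_le_iff)
qed simp

lemma ladder_neq_zero: "ladder h w \<noteq> (\<lambda>_. 0)"
  by (metis add.right_neutral ladder_eq_0_iff le0 mult_0_right)

lemma zero_less_ladder: "(\<lambda>_. 0) < ladder h w"
  using ladder_neq_zero[of h w] by (metis le_fun_def order_less_le zero_le)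

lemma not_ladder_less_zero: "\<not> ladder h w < (\<lambda>_. 0)"
  using zero_less_ladder[of h w] by (meson less_asym)

text \<open>Supports are intersected: starts of different parity give disjoint supports, otherwise
  the rungs from \<open>w\<close> up to the lower of the two tops remain. The guard on
  \<open>(w - w') div 2\<close> covers the case that all of \<open>ladder h' w'\<close> lies below
  \<open>w\<close>, where truncated subtraction would leave a spurious rung.\<close>

lemma inf_ladder:
  assumes "w' \<le> w"
  shows "inf (ladder h w) (ladder h' w') =
    (if even (w - w') \<and> (w - w') div 2 \<le> h' then ladder (min h (h' - (w - w') div 2)) w else (\<lambda>_. 0))"
proof (cases "even (w - w')")
  case False
  have "w + 2 * i \<noteq> w' + 2 * j" for i j
    using False assms by presburger
  with False show ?thesis
    by (auto simp: fun_eq_iff inf_fun_def inf_nat_def ladder_def)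
next
  case True
  then obtain d where "w - w' = 2 * d" by (elim evenE)
  with assms have w: "w = w' + 2 * d" by simp
  have "(\<exists>j\<le>h'. w + 2 * i = w' + 2 * j) \<longleftrightarrow> i + d \<le> h'" for i
    unfolding w by (auto intro: exI[of _ "i + d"])
  then have *: "ladder h' w' (w + 2 * i) = (if i + d \<le> h' then 1 else 0)" for i
    by (simp add: ladder_def)
  show ?thesis
  proof
    fix k
    show "inf (ladder h w) (ladder h' w') k = (if even (w - w') \<and> (w - w') div 2 \<le> h'
        then ladder (min h (h' - (w - w') div 2)) w else (\<lambda>_. 0)) k"
    proof (cases "\<exists>i. k = w + 2 * i")
      case True
      then obtain i where k: "k = w + 2 * i" ..
      have "ladder a w k = (if i \<le> a then 1 else 0)" for a
        unfolding k by (auto simp: ladder_def)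
      moreover have "(w - w') div 2 = d" "even (w - w')" using w by simp_all
      ultimately show ?thesis using * k by (auto simp: inf_fun_def inf_nat_def)
    next
      case False
      then have "ladder a w k = 0" for a by (auto simp: ladder_eq_0_iff)
      then show ?thesis by (simp add: inf_fun_def inf_nat_def)
    qed
  qed
qed

section \<open>Minima of sets of ladders\<close>

lemma coordinatewise_min_singleton: "coordinatewise_min {x} = x"
  by (simp add: coordinatewise_min_def)

lemma coordinatewise_min_insert:
  assumes "finite X" "X \<noteq> {}"
  shows "coordinatewise_min (insert x X) = inf x (coordinatewise_min X)"
  using assms by (auto simp: coordinatewise_min_def inf_fun_def inf_nat_def)

text \<open>The minimum over a finite set is an iterated binary \<open>inf\<close>, so closure under
  pairs suffices.\<close>

lemma coordinatewise_min_closed: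
  assumes "finite X" "X \<noteq> {}" "X \<subseteq> R" "\<And>x y. x \<in> R \<Longrightarrow> y \<in> R \<Longrightarrow> inf x y \<in> R"
  shows "coordinatewise_min X \<in> R"
  using assms(1,2,3)
proof (induction rule: finite_ne_induct)
  case (insert x X)
  then have "inf x (coordinatewise_min X) \<in> R" by (intro assms(4)) auto
  with insert.hyps show ?case by (metis coordinatewise_min_insert)
qed (simp add: coordinatewise_min_singleton)

text \<open>The truncation \<open>[i]\<^sup>w\<close> of \<open>[h]\<^sup>w\<close> is either itself in the family or the minimum of
  \<open>[h]\<^sup>w\<close> and the ladder \<open>[h]\<close> shifted down so that its top rung is the one of \<open>[i]\<^sup>w\<close>.\<close>

lemma coordinatewise_min_ladders:
  fixes W :: "nat \<Rightarrow> nat"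
  assumes E: "E = {ladder h w | h w. h \<le> H \<and> w \<le> W h}"
    and W0: "0 < W 0"
    and W: "\<And>i h w. i \<le> h \<Longrightarrow> h \<le> H \<Longrightarrow> w \<le> W h \<Longrightarrow> w \<le> W i \<or> 2 * (h - i) \<le> w"
  shows "{coordinatewise_min X | X. X \<subseteq> E \<and> X \<noteq> {}} =
    {\<lambda>_. 0} \<union> E \<union> {ladder i w | i h w. i \<le> h \<and> ladder h w \<in> E}" (is "?M = ?R")
proof
  \<comment> \<open>A finite index set makes every \<open>X \<subseteq> E\<close> finite, so that
    \<open>coordinatewise_min X\<close> reduces to binary minima.\<close>
  have "E = (\<lambda>(h, w). ladder h w) ` (SIGMA h:{..H}. {..W h})"
    by (auto simp: E)
  then have fin: "finite E" by simp
  \<comment> \<open>The minimum keeps the higher start \<open>w\<close> and at most the rungs of the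
    ladder starting there, so the same member \<open>ladder h w\<close> of \<open>E\<close>
    witnesses that it is a truncation.\<close>
  have inf_le: "inf (ladder i w) (ladder i' w') \<in> ?R"
    if "w' \<le> w" "i \<le> h" "ladder h w \<in> E" for i w i' w' h
  proof -
    have "ladder (min i (i' - (w - w') div 2)) w \<in> ?R"
      using that by (auto intro: min.coboundedI1)
    then show ?thesis using inf_ladder[OF that(1), of i i'] by simp
  qed
  have ladder_of: "x = (\<lambda>_. 0) \<or> (\<exists>i w h. x = ladder i w \<and> i \<le> h \<and> ladder h w \<in> E)"
    if "x \<in> ?R" for x
  proof -
    have "\<exists>h w. x = ladder h w" if "x \<in> E" using that by (auto simp: E)
    with that show ?thesis by blast
  qed
  have inf_closed: "inf x y \<in> ?R" if xR: "x \<in> ?R" and yR: "y \<in> ?R" for x y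
  proof (cases "x = (\<lambda>_. 0) \<or> y = (\<lambda>_. 0)")
    case True
    then have "inf x y = (\<lambda>_. 0)" by (auto simp: inf_fun_def inf_nat_def)
    then show ?thesis by simp
  next
    case False
    obtain i w h where x: "x = ladder i w" "i \<le> h" "ladder h w \<in> E"
      using ladder_of[OF xR] False by blast
    obtain i' w' h' where y: "y = ladder i' w'" "i' \<le> h'" "ladder h' w' \<in> E"
      using ladder_of[OF yR] False by blast
    show ?thesis
      using inf_le[of w' w i h i'] inf_le[of w w' i' h' i] x y
      by (cases "w' \<le> w") (simp_all add: inf.commute)
  qed
  show "?M \<subseteq> ?R"
  proof
    fix x assume "x \<in> ?M"
    then obtain X where "x = coordinatewise_min X" "X \<subseteq> E" "X \<noteq> {}" by blast
    moreover have "E \<subseteq> ?R" by blast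
    ultimately show "x \<in> ?R"
      using coordinatewise_min_closed[of X ?R] inf_closed finite_subset[OF _ fin] by simp
  qed
next
  have mem: "ladder h w \<in> E \<longleftrightarrow> h \<le> H \<and> w \<le> W h" for h w
    by (auto simp: E ladder_eq_iff)
  have single: "x \<in> ?M" if "x \<in> E" for x
    using that coordinatewise_min_singleton[of x] by force
  have two: "z \<in> ?M" if "x \<in> E" "y \<in> E" "inf x y = z" for x y z
  proof -
    have "z = coordinatewise_min {x, y}"
      using that(3) by (simp add: coordinatewise_min_insert coordinatewise_min_singleton)
    then show ?thesis using that(1,2) by blast
  qed
  have trunc: "ladder i w \<in> ?M" if "i \<le> h" "h \<le> H" "w \<le> W h" for i h w
  proof (cases "w \<le> W i")
    case True
    with that have "ladder i w \<in> E" by (simp add: mem)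
    then show ?thesis by (rule single)
  next
    case False
    \<comment> \<open>The assumption \<open>W\<close> makes the subtraction
      \<open>w - 2 * (h - i)\<close> exact, so the shifted ladder really ends at
      \<open>w + 2 * i\<close>; its start is at most \<open>w\<close>, which keeps it in
      \<open>E\<close>.\<close>
    with W that have *: "2 * (h - i) \<le> w" by blast
    then have "inf (ladder h w) (ladder h (w - 2 * (h - i))) = ladder i w"
      using that by (subst inf_ladder) auto
    moreover have "ladder h w \<in> E" "ladder h (w - 2 * (h - i)) \<in> E"
      using that by (auto simp: mem)
    ultimately show ?thesis using two by blast
  qed
  \<comment> \<open>Zero is the minimum of two one-rung ladders whose starts differ in parity;
    \<open>W0\<close> supplies the second.\<close>
  have "ladder 0 0 \<in> E" "ladder 0 1 \<in> E" using W0 by (auto simp: mem)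
  moreover have "inf (ladder 0 1) (ladder 0 0) = (\<lambda>_. 0)"
    by (subst inf_ladder) auto
  ultimately have "(\<lambda>_. 0) \<in> ?M" using two by blast
  moreover have "ladder i w \<in> ?M" if "i \<le> h" "ladder h w \<in> E" for i h w
    using trunc[OF that(1)] that(2) mem by blast
  ultimately show "?R \<subseteq> ?M" using single by blast
qed

section \<open>Covers among ladders\<close>

lemma ladder_less_iff:
  "ladder h w < ladder h' w' \<longleftrightarrow> (\<exists>d. w = w' + 2 * d \<and> h + d \<le> h' \<and> (0 < d \<or> h < h'))"
  unfolding order_less_le ladder_le_iff ladder_eq_iff by auto

text \<open>Ladders behave as intervals. If the top of \<open>x\<close> is below that of
  \<open>y\<close>, then \<open>y\<close> without its top rung, present by \<open>down\<close>, lies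
  between them. If the tops agree, \<open>x\<close> is \<open>y\<close> with its lowest rungs
  removed, and a cover removes as few of them as \<open>P\<close> allows.\<close>

lemma covering_relations_ladders:
  assumes P: "P = insert (\<lambda>_. 0) {ladder h w | h w. (h, w) \<in> L}"
    and down: "\<And>i h w. (h, w) \<in> L \<Longrightarrow> i \<le> h \<Longrightarrow> (i, w) \<in> L"
  shows "covering_relations P =
           {(\<lambda>_. 0, ladder 0 w) | w. ladder 0 w \<in> P}
         \<union> {(ladder (h - 1) w, ladder h w) | h w. ladder h w \<in> P \<and> h \<ge> 1}
         \<union> {(ladder (h - i) (w + 2 * i), ladder h w) | h w i.
              ladder h w \<in> P \<and> 0 < i \<and> i \<le> h
              \<and> ladder (h - i) (w + 2 * i) \<in> P
              \<and> (\<forall>j. 0 < j \<and> j < i \<longrightarrow> ladder (h - j) (w + 2 * j) \<notin> P)}"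
    (is "_ = ?Z \<union> ?A \<union> ?B")
proof -
  have mem: "ladder h w \<in> P \<longleftrightarrow> (h, w) \<in> L" for h w
    using ladder_neq_zero by (auto simp: P ladder_eq_iff)
  have zero: "(\<lambda>_. 0) \<in> P" by (simp add: P)
  have cases: "x = (\<lambda>_. 0) \<or> (\<exists>h w. x = ladder h w \<and> (h, w) \<in> L)" if "x \<in> P" for x
    using that by (auto simp: P)
  have cov: "(x, y) \<in> ?Z \<union> ?A \<union> ?B" if "(x, y) \<in> covering_relations P" for x y
  proof -
    have xy: "x \<in> P" "y \<in> P" "x < y" and no: "\<And>z. z \<in> P \<Longrightarrow> x < z \<Longrightarrow> \<not> z < y"
      using that by (auto simp: covering_relations_def)
    obtain h w where y: "y = ladder h w" "(h, w) \<in> L"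
      using cases[OF xy(2)] xy(3) cases[OF xy(1)] not_ladder_less_zero by fastforce
    show ?thesis
    proof (cases "x = (\<lambda>_. 0)")
      case True
      \<comment> \<open>By \<open>down\<close> the lowest rung alone is in \<open>P\<close>, above
        zero and below any longer \<open>y\<close>.\<close>
      have "\<not> ladder 0 w < ladder h w"
        using no[of "ladder 0 w"] True zero_less_ladder down[OF y(2)] mem y(1) by blast
      then have "h = 0" by (auto simp: ladder_less_iff)
      then show ?thesis using True y mem by blast
    next
      case False
      then obtain h' w' where x: "x = ladder h' w'" "(h', w') \<in> L"
        using cases[OF xy(1)] by blast
      obtain d where d: "w' = w + 2 * d" "h' + d \<le> h" "0 < d \<or> h' < h"
        using xy(3) x y by (auto simp: ladder_less_iff)
      show ?thesis
      \<comment> \<open>The equation says that the top rungs \<open>w' + 2 * h'\<close> and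
        \<open>w + 2 * h\<close> coincide.\<close>
      proof (cases "h' + d = h")
        case True
        then have h': "h' = h - d" and dh: "d \<le> h" by simp_all
        have d0: "0 < d" using d True by auto
        have "ladder (h - j) (w + 2 * j) \<notin> P" if j: "0 < j" "j < d" for j
        proof
          assume "ladder (h - j) (w + 2 * j) \<in> P"
          moreover have "x < ladder (h - j) (w + 2 * j)"
            unfolding x ladder_less_iff using j True d(1) by (intro exI[of _ "d - j"]) auto
          moreover have "ladder (h - j) (w + 2 * j) < y"
            unfolding y ladder_less_iff using j dh by auto
          ultimately show False using no by blast
        qed
        then have "(x, y) \<in> ?B"
          using x y h' dh d0 d(1) mem by auto
        then show ?thesis by blast
      next
        case False
        then have h: "h \<ge> 1" "h' + d \<le> h - 1" using d(2) by auto
        have "ladder (h - 1) w \<in> P" using down y mem by simp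
        moreover have "ladder (h - 1) w < y"
          unfolding y ladder_less_iff using h by auto
        ultimately have "\<not> x < ladder (h - 1) w" using no by blast
        moreover have "x \<le> ladder (h - 1) w"
          unfolding x ladder_le_iff using d h by auto
        ultimately have "x = ladder (h - 1) w" by (simp add: order_less_le)
        then show ?thesis using y mem h by blast
      qed
    qed
  qed
  have Z: "(x, y) \<in> covering_relations P" if "(x, y) \<in> ?Z" for x y
  proof -
    obtain w where w: "x = (\<lambda>_. 0)" "y = ladder 0 w" "y \<in> P" using \<open>(x, y) \<in> ?Z\<close> by blast
    have "\<not> z < y" if "z \<in> P" "x < z" for z
      using cases[OF that(1)] that(2) w(1,2) by (auto simp: ladder_less_iff)
    then show ?thesis using w zero zero_less_ladder by (auto simp: covering_relations_def)
  qed
  have A: "(x, y) \<in> covering_relations P" if "(x, y) \<in> ?A" for x y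
  proof -
    obtain h w where w: "x = ladder (h - 1) w" "y = ladder h w" "y \<in> P" "h \<ge> 1"
      using \<open>(x, y) \<in> ?A\<close> by blast
    have "\<not> z < y" if z: "z \<in> P" "x < z" for z
    proof
      assume "z < y"
      moreover obtain h' w' where "z = ladder h' w'"
        using cases[OF z(1)] z(2) not_ladder_less_zero w(1) by blast
      ultimately show False using z(2) unfolding w by (auto simp: ladder_less_iff)
    qed
    moreover have "x \<in> P" using w down mem by simp
    moreover have "x < y" unfolding w ladder_less_iff using w(4) by auto
    ultimately show ?thesis using w by (auto simp: covering_relations_def)
  qed
  have B: "(x, y) \<in> covering_relations P" if "(x, y) \<in> ?B" for x y
  proof -
    obtain h w i where w: "x = ladder (h - i) (w + 2 * i)" "y = ladder h w" "x \<in> P" "y \<in> P"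
      and i: "0 < i" "i \<le> h"
      and minimal: "\<And>j. 0 < j \<Longrightarrow> j < i \<Longrightarrow> ladder (h - j) (w + 2 * j) \<notin> P"
      using \<open>(x, y) \<in> ?B\<close> by blast
    have "\<not> z < y" if z: "z \<in> P" "x < z" for z
    proof
      assume zy: "z < y"
      obtain h' w' where zl: "z = ladder h' w'"
        using cases[OF z(1)] z(2) not_ladder_less_zero w(1) by blast
      obtain d where d: "w' = w + 2 * d" "h' + d \<le> h" "0 < d \<or> h' < h"
        using zy unfolding zl w by (auto simp: ladder_less_iff)
      obtain e where e: "w + 2 * i = w' + 2 * e" "h - i + e \<le> h'" "0 < e \<or> h - i < h'"
        using z(2) unfolding zl w by (auto simp: ladder_less_iff)
      \<comment> \<open>As \<open>x\<close> and \<open>y\<close> share their top, a ladder between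
        them shares it too. So \<open>z\<close> is \<open>y\<close> with its \<open>d\<close> lowest
        rungs removed, where \<open>0 < d\<close> and \<open>d < i\<close>, against minimality of
        \<open>i\<close>.\<close>
      have "i = d + e" using d e by simp
      with d e i have "h' = h - d" "0 < d" "d < i" by auto
      with minimal z(1) zl d(1) show False by blast
    qed
    moreover have "x < y" unfolding w ladder_less_iff using i by auto
    ultimately show ?thesis using w by (auto simp: covering_relations_def)
  qed
  show ?thesis
    by (rule subset_antisym) (rule subrelI, erule cov, intro Un_least subrelI, fact Z, fact A, fact B)
qed

section \<open>Directed trees\<close>

lemma nth_in_drop: "k \<le> l \<Longrightarrow> l < length xs \<Longrightarrow> xs ! l \<in> set (drop k xs)"
  by (auto simp: in_set_conv_nth intro!: exI[of _ "l - k"])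

section \<open>Walks as vertex lists, and undirected cycles\<close>

lemma vwalk_Cons_iff:
  "vwalk (a # p) (with_proj G) \<longleftrightarrow>
    a \<in> pverts G \<and> (p \<noteq> [] \<longrightarrow> (a, hd p) \<in> parcs G \<and> vwalk p (with_proj G))"
  by (cases p) (auto simp: vwalk_def)

lemma vwalk_snoc_iff:
  "vwalk (p @ [a]) (with_proj G) \<longleftrightarrow>
    a \<in> pverts G \<and> (p \<noteq> [] \<longrightarrow> (last p, a) \<in> parcs G \<and> vwalk p (with_proj G))"
  by (cases "p = []") (auto simp: vwalk_def set_vwalk_arcs_snoc)

lemma vwalk_reaches:
  fixes G :: "'a pair_pre_digraph"
  assumes "vwalk (a # p) (with_proj G)" "x \<in> set p"
  shows "(a, x) \<in> (parcs G)\<^sup>+"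
  using assms
proof (induction p arbitrary: a)
  case (Cons b p)
  then have "(a, b) \<in> parcs G" "vwalk (b # p) (with_proj G)"
    by (auto simp: vwalk_Cons_iff)
  with Cons show ?case by (auto intro: trancl_into_trancl2)
qed simp

text \<open>A repeated vertex would reach itself along a nonempty stretch of arcs. Directed paths
  can therefore be handled as plain walks.\<close>

lemma acyclic_vwalk_distinct:
  assumes "acyclic (parcs G)" "vwalk p (with_proj G)"
  shows "distinct p"
  using assms(2)
proof (induction p rule: list.induct)
  case (Cons a p)
  have "a \<notin> set p"
    using vwalk_reaches[OF Cons.prems] assms(1) by (auto simp: acyclic_def)
  then show ?case using Cons by (cases "p = []") (auto simp: vwalk_Cons_iff)
qed simp

lemma length_vwalk_arcs: "length (vwalk_arcs xs) = length xs - 1"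
  by (metis vwalk_length_def vwalk_length_simp)

lemma pcas_vwalk_arcs: "xs \<noteq> [] \<Longrightarrow> pcas (hd xs) (vwalk_arcs xs) (last xs)"
  by (induction xs rule: vwalk_arcs.induct) auto

lemma pawalk_verts_vwalk_arcs: "xs \<noteq> [] \<Longrightarrow> pawalk_verts (hd xs) (vwalk_arcs xs) = xs"
  by (induction xs rule: vwalk_arcs.induct) auto

text \<open>Translates closed vertex lists into the arc lists in which
  \<open>undirected_tree\<close> forbids cycles.\<close>

lemma cycle_vwalk_arcs:
  assumes "vwalk xs (with_proj H)" "hd xs = last xs" "distinct (tl xs)" "2 \<le> length xs"
  shows "pre_digraph.cycle (with_proj H) (vwalk_arcs xs)"
proof -
  have ne: "xs \<noteq> []" using assms(4) by auto
  have "pre_digraph.awalk (with_proj H) (hd xs) (vwalk_arcs xs) (hd xs)"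
    using assms(1) ne pcas_vwalk_arcs[OF ne] assms(2)
    by (auto simp: pre_digraph.awalk_def cas_with_proj_eq vwalk_def)
  moreover have "vwalk_arcs xs \<noteq> []"
    using assms(4) length_vwalk_arcs[of xs] by auto
  ultimately show ?thesis
    using assms(3) pawalk_verts_vwalk_arcs[OF ne]
    unfolding pre_digraph.cycle_def awalk_verts_with_proj_eq by metis
qed

lemma parcs_mk_symmetric_with_proj: "parcs (mk_symmetric (with_proj G)) = parcs G \<union> (parcs G)\<inverse>"
  by (auto simp: parcs_mk_symmetric)

lemma vwalk_mk_symmetric:
  assumes "vwalk p (with_proj G)"
  shows "vwalk p (with_proj (mk_symmetric (with_proj G)))"
  using assms by (auto simp: vwalk_def parcs_mk_symmetric_with_proj)

lemma vwalk_mk_symmetric_rev: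
  assumes "vwalk p (with_proj G)"
  shows "vwalk (rev p) (with_proj (mk_symmetric (with_proj G)))"
  using assms by (auto simp: vwalk_def parcs_mk_symmetric_with_proj set_vwalk_arcs_rev)

section \<open>Uniqueness of paths from the root\<close>

locale dir_tree =
  fixes G :: "nat pair_pre_digraph"
  assumes directed_tree: "directed_tree G"
begin

sublocale pair_fin_digraph G
  using directed_tree by (simp add: directed_tree_def)

abbreviation walk :: "nat list \<Rightarrow> bool" where
  "walk p \<equiv> vwalk p (with_proj G)"

lemma acyclic_parcs: "acyclic (parcs G)"
  using directed_tree by (simp add: directed_tree_def)

lemma source_iff: "source G v \<longleftrightarrow> v = root G"
  using directed_tree theI'[of "source G"] unfolding directed_tree_def root_def by metis

lemma root_in_verts: "root G \<in> pverts G"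
  using source_iff[of "root G"] by (simp add: source_def)

lemma no_arc_to_root: "(u, root G) \<notin> parcs G"
  using source_iff[of "root G"] by (simp add: source_def)

lemma walk_distinct: "walk p \<Longrightarrow> distinct p"
  by (rule acyclic_vwalk_distinct[OF acyclic_parcs])

lemma dipath_iff: "dipath G p \<longleftrightarrow> walk p"
  using walk_distinct by (auto simp: vpath_def)

text \<open>A finite acyclic arc relation is well-founded, so going back along incoming arcs stops,
  and it can stop only at the unique source.\<close>

lemma walk_from_root:
  assumes "v \<in> pverts G"
  shows "\<exists>p. walk p \<and> hd p = root G \<and> last p = v"
proof -
  have "wf (parcs G)"
    using pair_finite_arcs acyclic_parcs by (rule finite_acyclic_wf)
  then show ?thesis using assms
  proof (induction v rule: wf_induct_rule)
    case (less v)
    show ?case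
    proof (cases "v = root G")
      case True
      with less.prems show ?thesis by (intro exI[of _ "[v]"]) (auto simp: vwalk_def)
    next
      case False
      then obtain u where u: "(u, v) \<in> parcs G"
        using source_iff[of v] less.prems by (auto simp: source_def)
      with less.IH obtain p where "walk p" "hd p = root G" "last p = u"
        by (blast dest: in_arcsD1)
      moreover from this have "p \<noteq> []" by auto
      ultimately show ?thesis
        using u less.prems by (intro exI[of _ "p @ [v]"]) (auto simp: vwalk_snoc_iff)
    qed
  qed
qed

text \<open>The list repeats its first vertex at the end, so four entries amount to three arcs, the
  threshold in \<open>undirected_tree\<close>.\<close>

lemma no_long_cycle:
  assumes "vwalk xs (with_proj (mk_symmetric (with_proj G)))" "hd xs = last xs"
    "distinct (tl xs)" "4 \<le> length xs"
  shows False
proof -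
  have "3 \<le> length (vwalk_arcs xs)" using assms(4) by (simp add: length_vwalk_arcs)
  moreover have "pre_digraph.cycle (with_proj (mk_symmetric (with_proj G))) (vwalk_arcs xs)"
    using assms by (intro cycle_vwalk_arcs) auto
  ultimately show False
    using directed_tree unfolding directed_tree_def undirected_tree_def by blast
qed

lemma walk_appendD:
  assumes "walk (p @ q)"
  shows "p \<noteq> [] \<Longrightarrow> walk p" "q \<noteq> [] \<Longrightarrow> walk q"
  using assms vwalkI_append_l vwalkI_append_r by blast+

text \<open>Two paths from the root to distinct parents, cut at a last common vertex, would close up
  through the child to an undirected cycle.\<close>

lemma unique_parent:
  assumes "(a, v) \<in> parcs G" "(b, v) \<in> parcs G"
  shows "a = b"
proof (rule ccontr)
  assume "a \<noteq> b"
  define D where "D p q \<longleftrightarrow> walk p \<and> walk q \<and> hd p = hd q \<and> last p = a \<and> last q = b" for p q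
  have "\<exists>pq. D (fst pq) (snd pq)"
    using walk_from_root[of a] walk_from_root[of b] assms in_arcsD1 unfolding D_def
    by (metis fst_conv snd_conv)
  \<comment> \<open>A pair of least total length replaces the cut at a last common vertex: cutting
    at a common vertex other than the start would give a shorter pair.\<close>
  then obtain pq where pq: "D (fst pq) (snd pq)"
    and least: "\<And>y. D (fst y) (snd y) \<Longrightarrow>
      length (fst pq) + length (snd pq) \<le> length (fst y) + length (snd y)"
    using ex_has_least_nat[of "\<lambda>y. D (fst y) (snd y)" _ "\<lambda>y. length (fst y) + length (snd y)"]
    by blast
  define p where "p = fst pq"
  define q where "q = snd pq"
  have D: "walk p" "walk q" "hd p = hd q" "last p = a" "last q = b"
    using pq by (simp_all add: D_def p_def q_def)
  have ne: "p \<noteq> []" "q \<noteq> []" using D by (auto simp: vwalk_def)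
  have common: "y = hd p" if yp: "y \<in> set p" and yq: "y \<in> set q" for y
  proof -
    obtain p1 p2 where p: "p = p1 @ y # p2" using split_list[OF yp] by blast
    obtain q1 q2 where q: "q = q1 @ y # q2" using split_list[OF yq] by blast
    have "D (y # p2) (y # q2)"
      using D walk_appendD(2)[of p1 "y # p2"] walk_appendD(2)[of q1 "y # q2"]
      unfolding D_def p q by simp
    from least[of "(y # p2, y # q2)"] this
    have "length p + length q \<le> length (y # p2) + length (y # q2)"
      by (simp add: p_def q_def)
    then have "p1 = []" by (simp add: p q)
    then show ?thesis by (simp add: p)
  qed
  obtain x q' where q: "q = x # q'" using ne by (cases q) auto
  have hdp: "hd p = x" using D q by simp
  have walk_pv: "walk (p @ [v])" and walk_qv: "walk (q @ [v])"
    using D ne assms in_arcsD2 by (auto simp: vwalk_snoc_iff)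
  \<comment> \<open>Down \<open>p\<close> to the child \<open>v\<close>, then back along
    \<open>q\<close> against the arcs to the common start.\<close>
  define xs where "xs = (p @ [v]) @ rev q"
  have "vwalk ((p @ [v]) \<oplus> rev (q @ [v])) (with_proj (mk_symmetric (with_proj G)))"
    by (intro vwalk_joinI_vwalk' vwalk_mk_symmetric walk_pv vwalk_mk_symmetric_rev walk_qv) simp
  then have "vwalk xs (with_proj (mk_symmetric (with_proj G)))"
    by (simp add: xs_def vwalk_join_def)
  moreover have "hd xs = last xs"
    using ne D by (simp add: xs_def last_rev)
  moreover have "distinct (tl xs)"
  proof -
    have "distinct (p @ [v])" "distinct (q @ [v])"
      using walk_pv walk_qv walk_distinct by blast+
    moreover have "set (tl p) \<inter> set q = {}"
      using common \<open>distinct (p @ [v])\<close> ne by (cases p) auto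
    moreover have "set (tl p) \<subseteq> set p" by (cases p) auto
    moreover have "tl xs = tl p @ [v] @ rev q"
      using ne by (simp add: xs_def)
    ultimately show ?thesis by (auto simp: distinct_tl)
  qed
  moreover have "4 \<le> length xs"
  proof -
    \<comment> \<open>Two one-vertex walks with the same start would force
      \<open>a = b\<close>.\<close>
    have "\<not> (length p = 1 \<and> length q = 1)"
      using D \<open>a \<noteq> b\<close> by (auto simp: length_Suc_conv)
    moreover have "length p \<ge> 1" "length q \<ge> 1" using ne by (auto simp: Suc_le_eq)
    ultimately have "3 \<le> length p + length q" by arith
    then show ?thesis by (simp add: xs_def)
  qed
  ultimately show False by (rule no_long_cycle)
qed

text \<open>Walks are determined backwards by their last vertex, so each is a suffix of a root path.\<close>

lemma walk_is_suffix:
  assumes "walk p" "walk q" "hd q = root G" "last p = last q"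
  shows "\<exists>k<length q. p = drop k q"
  using assms
proof (induction p arbitrary: q rule: rev_induct)
  case (snoc v p)
  obtain q' where q: "q = q' @ [v]"
    using snoc.prems(2,4) by (metis append_butlast_last_id last_snoc vwalkE)
  show ?case
  proof (cases "p = []")
    case True
    then show ?thesis by (intro exI[of _ "length q'"]) (simp add: q)
  next
    case False
    then have p: "(last p, v) \<in> parcs G" "walk p"
      using snoc.prems(1) by (auto simp: vwalk_snoc_iff)
    have "q' \<noteq> []"
    proof
      assume "q' = []"
      then have "v = root G" using snoc.prems(3) q by simp
      with p(1) no_arc_to_root show False by simp
    qed
    then have q': "(last q', v) \<in> parcs G" "walk q'" "hd q' = root G"
      using snoc.prems(2,3) by (auto simp: vwalk_snoc_iff q)
    then obtain k where "k < length q'" "p = drop k q'"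
      using snoc.IH[OF p(2) q'(2,3)] unique_parent[OF p(1) q'(1)] by blast
    then show ?thesis by (intro exI[of _ k]) (auto simp: q)
  qed
qed (simp add: vwalk_def)

section \<open>Root paths and heights\<close>

text \<open>The same description as inside \<open>vertex_height\<close>, so that heights are lengths
  of root paths by unfolding.\<close>

definition rpath :: "nat \<Rightarrow> nat list" where
  "rpath v = (THE p. dipath G p \<and> hd p = root G \<and> last p = v)"

lemma walk_root_unique:
  assumes "walk p" "hd p = root G" "walk q" "hd q = root G" "last p = last q"
  shows "p = q"
proof -
  obtain k where k: "k < length q" "p = drop k q"
    using walk_is_suffix[of p q] assms by blast
  obtain j where j: "j < length p" "q = drop j p"
    using walk_is_suffix[of q p] assms by metis
  have "length p = length q - k" "length q = length p - j"
    using k(2) j(2) by (metis length_drop)+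
  with k(1) have "k = 0" by linarith
  with k(2) show ?thesis by simp
qed

lemma rpath_eqI:
  assumes "walk p" "hd p = root G" "last p = v"
  shows "rpath v = p"
  unfolding rpath_def dipath_iff
  by (rule the_equality) (use assms walk_root_unique in blast)+

lemma rpath:
  assumes "v \<in> pverts G"
  shows walk_rpath: "walk (rpath v)" and hd_rpath: "hd (rpath v) = root G"
    and last_rpath: "last (rpath v) = v"
  using walk_from_root[OF assms] rpath_eqI by auto

abbreviation height :: "nat \<Rightarrow> nat" where
  "height \<equiv> vertex_height G"

lemma height_eq: "height v = length (rpath v) - 1"
  unfolding vertex_height_def rpath_def by simp

lemma length_rpath:
  assumes "v \<in> pverts G"
  shows "length (rpath v) = Suc (height v)"
  using walk_rpath[OF assms] by (auto simp: height_eq vwalk_def Suc_le_eq)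

lemma rpath_nth_verts:
  assumes "v \<in> pverts G" "k \<le> height v"
  shows "rpath v ! k \<in> pverts G"
  using walk_rpath[OF assms(1)] length_rpath[OF assms(1)] assms(2)
  by (auto simp: vwalk_def)

text \<open>A prefix of a root path is again a walk from the root, so uniqueness identifies it.
  Positions on a root path are thereby heights.\<close>

lemma rpath_nth:
  assumes "v \<in> pverts G" "k \<le> height v"
  shows "rpath (rpath v ! k) = take (Suc k) (rpath v)"
proof (rule rpath_eqI)
  have "walk (take (Suc k) (rpath v) @ drop (Suc k) (rpath v))"
    using walk_rpath[OF assms(1)] by simp
  then show "walk (take (Suc k) (rpath v))"
    by (rule walk_appendD) (use length_rpath[OF assms(1)] in auto)
  show "hd (take (Suc k) (rpath v)) = root G"
    using hd_rpath[OF assms(1)] by simp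
  show "last (take (Suc k) (rpath v)) = rpath v ! k"
    using length_rpath[OF assms(1)] assms(2) by (simp add: take_Suc_conv_app_nth)
qed

lemma height_rpath_nth:
  assumes "v \<in> pverts G" "k \<le> height v"
  shows "height (rpath v ! k) = k"
  unfolding height_eq[of "rpath v ! k"] rpath_nth[OF assms]
  using length_rpath[OF assms(1)] assms(2) by simp

lemma walk_ends:
  assumes "walk p"
  shows "hd p \<in> pverts G" "last p \<in> pverts G"
  using assms by (auto simp: vwalk_def)

lemma walk_drop_rpath:
  assumes "v \<in> pverts G" "k \<le> height v"
  shows "walk (drop k (rpath v))" "hd (drop k (rpath v)) = rpath v ! k"
    "last (drop k (rpath v)) = v"
proof -
  have k: "k < length (rpath v)" using length_rpath assms by simp
  then show "hd (drop k (rpath v)) = rpath v ! k" "last (drop k (rpath v)) = v"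
    using last_rpath[OF assms(1)] by (simp_all add: hd_drop_conv_nth)
  have "walk (take k (rpath v) @ drop k (rpath v))"
    using walk_rpath[OF assms(1)] by simp
  then show "walk (drop k (rpath v))"
    by (rule walk_appendD) (use k in auto)
qed

text \<open>The cut point given by \<open>walk_is_suffix\<close> is the height of the first vertex;
  hence a walk is determined by its last vertex and the height of its first.\<close>

lemma walk_eq_drop_rpath:
  assumes "walk p"
  shows "height (hd p) \<le> height (last p)" "p = drop (height (hd p)) (rpath (last p))"
proof -
  define v where "v = last p"
  have v: "v \<in> pverts G" using walk_ends(2)[OF assms] by (simp add: v_def)
  have "last p = last (rpath v)" unfolding last_rpath[OF v] by (simp only: v_def)
  from walk_is_suffix[OF assms walk_rpath[OF v] hd_rpath[OF v] this]
  obtain k where k: "k < length (rpath v)" "p = drop k (rpath v)" by blast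
  have le: "k \<le> height v" using k(1) length_rpath[OF v] by simp
  have "hd p = rpath v ! k" unfolding k(2) using k(1) by (rule hd_drop_conv_nth)
  with le have "height (hd p) = k" using height_rpath_nth[OF v] by simp
  then show "height (hd p) \<le> height (last p)" "p = drop (height (hd p)) (rpath (last p))"
    using le k(2) unfolding v_def[symmetric] by simp_all
qed

lemma vwalk_length_walk:
  assumes "walk p"
  shows "height (hd p) + vwalk_length p = height (last p)"
proof -
  have "length p = length (rpath (last p)) - height (hd p)"
    using walk_eq_drop_rpath(2)[OF assms] by (metis length_drop)
  then show ?thesis
    using walk_eq_drop_rpath(1)[OF assms] length_rpath[OF walk_ends(2)[OF assms]] by simp
qed

section \<open>Heights, widths and lengths as attained maxima\<close>

text \<open>Walks are distinct lists over a finite vertex set. The \<open>Max\<close> in the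
  definitions of height, width and length relies on this finiteness.\<close>

lemma finite_walks: "finite {p. walk p}"
proof (rule finite_subset)
  show "{p. walk p} \<subseteq> {p. set p \<subseteq> pverts G \<and> distinct p}"
    using walk_distinct by (auto simp: vwalk_def)
  show "finite {p. set p \<subseteq> pverts G \<and> distinct p}"
    by (rule finite_subset_distinct[OF pair_finite_verts])
qed

lemma finite_treks: "finite {T. is_trek G T}"
proof (rule finite_subset)
  show "{T. is_trek G T} \<subseteq> {p. walk p} \<times> {p. walk p}"
    by (auto simp: is_trek_def dipath_iff)
qed (simp add: finite_walks)

lemma finite_trek_lengths: "finite {trek_length T | T. is_trek G T \<and> Q T}"
proof -
  have "finite {T. is_trek G T \<and> Q T}"
    using finite_treks by (rule rev_finite_subset) blast
  then show ?thesis by (simp only: setcompr_eq_image finite_imageI)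
qed

lemma trek_length_le_max: "is_trek G T \<Longrightarrow> trek_length T \<le> max_trek_length G"
  unfolding max_trek_length_def using finite_trek_lengths[of "\<lambda>_. True"]
  by (intro Max_ge) (simp_all only: simp_thms, blast)

lemma trek_length_le_width:
  assumes "simple_trek G T"
  shows "trek_length T \<le> trek_width G (height (trek_top T))"
proof -
  let ?Q = "\<lambda>T'. set (fst T') \<inter> set (snd T') = {trek_top T'} \<and> height (trek_top T') = height (trek_top T)"
  have "{trek_length T' | T'. simple_trek G T' \<and> height (trek_top T') = height (trek_top T)}
      = {trek_length T' | T'. is_trek G T' \<and> ?Q T'}"
    unfolding simple_trek_def by blast
  with finite_trek_lengths[of ?Q] show ?thesis
    unfolding trek_width_def by (intro Max_ge) (simp_all only:, use assms simple_trek_def in blast)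
qed

lemma height_le_graph_height:
  assumes "v \<in> pverts G"
  shows "height v \<le> graph_height G"
proof -
  have "height v = vwalk_length (rpath v)" by (simp add: height_eq)
  then show ?thesis
    unfolding graph_height_def dipath_iff
    using finite_walks walk_rpath[OF assms] by (intro Max_ge) auto
qed

text \<open>The root path to the end of a longest path passes through every height up to that
  length.\<close>

lemma ex_height:
  assumes "h \<le> graph_height G"
  shows "\<exists>v\<in>pverts G. height v = h"
proof -
  have "graph_height G \<in> {vwalk_length p | p. walk p}"
    unfolding graph_height_def dipath_iff
  proof (rule Max_in)
    show "finite {vwalk_length p | p. walk p}" using finite_walks by simp
    show "{vwalk_length p | p. walk p} \<noteq> {}" using walk_rpath[OF root_in_verts] by blast
  qed
  then obtain p where p: "walk p" "vwalk_length p = graph_height G" by auto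
  then have "h \<le> height (last p)" using vwalk_length_walk[OF p(1)] assms by linarith
  then show ?thesis
    using rpath_nth_verts[OF walk_ends(2)[OF p(1)]] height_rpath_nth[OF walk_ends(2)[OF p(1)]]
    by blast
qed

lemma ex_widest_trek:
  assumes "h \<le> graph_height G"
  shows "\<exists>T. simple_trek G T \<and> height (trek_top T) = h \<and> trek_length T = trek_width G h"
proof -
  let ?A = "{trek_length T | T. simple_trek G T \<and> height (trek_top T) = h}"
  obtain v where v: "v \<in> pverts G" "height v = h" using ex_height[OF assms] by blast
  \<comment> \<open>The trivial trek makes the set of lengths nonempty, so its maximum is
    attained.\<close>
  then have "simple_trek G ([v], [v])"
    by (simp add: simple_trek_def is_trek_def dipath_iff trek_top_def vwalk_Cons_iff)
  with v have "?A \<noteq> {}" by (fastforce simp: trek_top_def)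
  moreover have "?A \<subseteq> {trek_length T | T. is_trek G T \<and> True}"
    by (auto simp: simple_trek_def)
  then have "finite ?A" by (rule finite_subset) (rule finite_trek_lengths)
  ultimately have "trek_width G h \<in> ?A" unfolding trek_width_def by (intro Max_in)
  then show ?thesis unfolding mem_Collect_eq by metis
qed

section \<open>Treks between two vertices\<close>

text \<open>Both legs are suffixes of root paths cut at the height of the common top, so treks
  correspond to the levels at which the two root paths agree.\<close>

lemma in_treks_between_iff:
  assumes "i \<in> pverts G" "j \<in> pverts G"
  shows "T \<in> treks_between G i j \<longleftrightarrow> (\<exists>k. k \<le> height i \<and> k \<le> height j \<and>
    rpath i ! k = rpath j ! k \<and> T = (drop k (rpath i), drop k (rpath j)))"
proof
  assume T: "T \<in> treks_between G i j"
  obtain p q where pq: "T = (p, q)" by (cases T)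
  have w: "walk p" "walk q" "hd p = hd q" "last p = i" "last q = j"
    using T by (auto simp: pq treks_between_def is_trek_def dipath_iff)
  define k where "k = height (hd p)"
  have k: "k \<le> height i" "k \<le> height j" "p = drop k (rpath i)" "q = drop k (rpath j)"
    using walk_eq_drop_rpath[OF w(1)] walk_eq_drop_rpath[OF w(2)] w(3-5) by (simp_all add: k_def)
  moreover have "rpath i ! k = rpath j ! k"
    using walk_drop_rpath(2)[OF assms(1) k(1)] walk_drop_rpath(2)[OF assms(2) k(2)] w(3) k(3,4)
    by simp
  ultimately show "\<exists>k. k \<le> height i \<and> k \<le> height j \<and>
    rpath i ! k = rpath j ! k \<and> T = (drop k (rpath i), drop k (rpath j))"
    using pq by blast
next
  assume "\<exists>k. k \<le> height i \<and> k \<le> height j \<and>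
    rpath i ! k = rpath j ! k \<and> T = (drop k (rpath i), drop k (rpath j))"
  then show "T \<in> treks_between G i j"
    using walk_drop_rpath assms by (auto simp: treks_between_def is_trek_def dipath_iff)
qed

text \<open>The root path of the vertex met at level \<open>h\<close> is a prefix of both root
  paths.\<close>

lemma rpath_agree_below:
  assumes "i \<in> pverts G" "j \<in> pverts G" "h \<le> height i" "h \<le> height j"
    and "rpath i ! h = rpath j ! h" "k \<le> h"
  shows "rpath i ! k = rpath j ! k"
proof -
  have "take (Suc h) (rpath i) = take (Suc h) (rpath j)"
    using rpath_nth[OF assms(1,3)] rpath_nth[OF assms(2,4)] assms(5) by simp
  then show ?thesis using assms(6) by (metis le_imp_less_Suc nth_take)
qed

text \<open>The top of a simple trek is the deepest level \<open>h\<close> at which the root paths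
  agree, and they agree at all levels up to it. Cutting at level \<open>h - d\<close> adds
  \<open>d\<close> arcs to each leg, which gives exactly one trek of each length
  \<open>trek_length T + 2 * d\<close> with \<open>d \<le> h\<close>.\<close>

lemma trek_vec_simple_trek:
  assumes T: "simple_trek G T" "T \<in> treks_between G i j"
  shows "trek_vec G i j = ladder (height (trek_top T)) (trek_length T)"
proof -
  have w: "walk (fst T)" "walk (snd T)" "last (fst T) = i" "last (snd T) = j"
    using T(2) by (auto simp: treks_between_def is_trek_def dipath_iff)
  have i: "i \<in> pverts G" and j: "j \<in> pverts G" using walk_ends(2) w by blast+
  define tr where "tr k = (drop k (rpath i), drop k (rpath j))" for k
  obtain h where h: "h \<le> height i" "h \<le> height j" "rpath i ! h = rpath j ! h" "T = tr h"
    using T(2) unfolding in_treks_between_iff[OF i j] tr_def by blast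
  have top: "trek_top T = rpath i ! h"
    using walk_drop_rpath(2)[OF i h(1)] by (simp add: trek_top_def h(4) tr_def)
  have height_top: "height (trek_top T) = h"
    unfolding top by (rule height_rpath_nth[OF i h(1)])
  \<comment> \<open>Agreement at a deeper level would put a vertex other than the top on both
    legs.\<close>
  have maximal: "k \<le> h" if k: "k \<le> height i" "k \<le> height j" "rpath i ! k = rpath j ! k" for k
  proof (rule ccontr)
    assume "\<not> k \<le> h"
    then have "rpath i ! k \<in> set (fst T)" "rpath j ! k \<in> set (snd T)"
      using k(1,2) length_rpath i j by (simp_all add: h(4) tr_def nth_in_drop)
    with T(1) k(3) have "rpath i ! k = trek_top T" by (auto simp: simple_trek_def)
    with height_top height_rpath_nth[OF i k(1)] \<open>\<not> k \<le> h\<close> show False by simp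
  qed
  have treks: "treks_between G i j = tr ` {..h}"
  proof (intro subset_antisym subsetI)
    fix T' assume "T' \<in> treks_between G i j"
    then show "T' \<in> tr ` {..h}"
      using maximal unfolding in_treks_between_iff[OF i j] tr_def by blast
  next
    fix T' assume "T' \<in> tr ` {..h}"
    then obtain k where "k \<le> h" "T' = tr k" by blast
    then show "T' \<in> treks_between G i j"
      using rpath_agree_below[OF i j h(1-3)] h(1,2)
      unfolding in_treks_between_iff[OF i j] tr_def by (intro exI[of _ k]) auto
  qed
  have len: "trek_length (tr k) = trek_length T + 2 * (h - k)" if "k \<le> h" for k
    using that h length_rpath[OF i] length_rpath[OF j] by (simp add: trek_length_def tr_def)
  show ?thesis
    unfolding height_top
  proof
    fix n
    show "trek_vec G i j n = ladder h (trek_length T) n"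
    proof (cases "\<exists>d\<le>h. n = trek_length T + 2 * d")
      case True
      then obtain d where d: "d \<le> h" "n = trek_length T + 2 * d" by blast
      then have eq: "{T' \<in> treks_between G i j. trek_length T' = n} = {tr (h - d)}"
        unfolding treks using len by force
      then have "tr (h - d) \<in> treks_between G i j" "trek_length (tr (h - d)) = n" by blast+
      \<comment> \<open>The cut-off in \<open>trek_vec\<close> does not affect lengths of existing
        treks.\<close>
      then have "n \<le> max_trek_length G"
        using trek_length_le_max[of "tr (h - d)"] by (simp add: treks_between_def)
      with eq show ?thesis using True by (simp add: trek_vec_def ladder_def)
    next
      case False
      have "trek_length T' \<noteq> n" if T': "T' \<in> treks_between G i j" for T'
      proof -
        obtain k where "k \<le> h" "T' = tr k" using T' unfolding treks by blast
        then have "trek_length T' = trek_length T + 2 * (h - k)" using len by simp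
        then show ?thesis using False diff_le_self[of h k] by blast
      qed
      then have eq: "{T' \<in> treks_between G i j. trek_length T' = n} = {}" by blast
      show ?thesis using False unfolding trek_vec_def ladder_def eq by simp
    qed
  qed
qed

text \<open>Cutting at the deepest level of agreement works; there is one, since both root paths
  start at the root.\<close>

lemma ex_simple_trek_between:
  assumes i: "i \<in> pverts G" and j: "j \<in> pverts G"
  shows "\<exists>T. simple_trek G T \<and> T \<in> treks_between G i j"
proof -
  define A where "A = {k. k \<le> height i \<and> k \<le> height j \<and> rpath i ! k = rpath j ! k}"
  have "rpath i ! 0 = root G" "rpath j ! 0 = root G"
    using hd_rpath[OF i] hd_rpath[OF j] length_rpath[OF i] length_rpath[OF j]
    by (metis hd_conv_nth length_0_conv nat.distinct(1))+
  then have "0 \<in> A" by (simp add: A_def)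
  have fin: "finite A" by (rule finite_subset[of _ "{..height i}"]) (auto simp: A_def)
  define h where "h = Max A"
  have "h \<in> A" using fin \<open>0 \<in> A\<close> unfolding h_def by (intro Max_in) auto
  then have h: "h \<le> height i" "h \<le> height j" "rpath i ! h = rpath j ! h"
    by (auto simp: A_def)
  define T where "T = (drop h (rpath i), drop h (rpath j))"
  have T: "T \<in> treks_between G i j"
    using h unfolding in_treks_between_iff[OF i j] T_def by blast
  have top: "trek_top T = rpath i ! h"
    using walk_drop_rpath(2)[OF i h(1)] by (simp add: trek_top_def T_def)
  have "y = trek_top T" if y: "y \<in> set (fst T)" "y \<in> set (snd T)" for y
  proof -
    obtain a where "a < length (drop h (rpath i))" "drop h (rpath i) ! a = y"
      using y(1) unfolding T_def in_set_conv_nth fst_conv by blast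
    then have a: "h + a \<le> height i" "rpath i ! (h + a) = y"
      using length_rpath[OF i] by auto
    obtain b where "b < length (drop h (rpath j))" "drop h (rpath j) ! b = y"
      using y(2) unfolding T_def in_set_conv_nth snd_conv by blast
    then have b: "h + b \<le> height j" "rpath j ! (h + b) = y"
      using length_rpath[OF j] by auto
    \<comment> \<open>A vertex occurs on any root path only at the level given by its height, so a
      common vertex sits at the same level on both.\<close>
    have "a = b"
      using height_rpath_nth[OF i a(1)] height_rpath_nth[OF j b(1)] a(2) b(2) by simp
    then have "h + a \<in> A" using a b by (simp add: A_def)
    then have "h + a \<le> h" using fin unfolding h_def by (intro Max_ge)
    then show ?thesis using a top by simp
  qed
  moreover have "trek_top T \<in> set (fst T)" "trek_top T \<in> set (snd T)"
    unfolding top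
    using nth_in_drop[of h h "rpath i"] nth_in_drop[of h h "rpath j"]
      h length_rpath[OF i] length_rpath[OF j] by (simp_all add: T_def)
  ultimately have "set (fst T) \<inter> set (snd T) = {trek_top T}" by blast
  with T have "simple_trek G T" by (simp add: simple_trek_def treks_between_def)
  with T show ?thesis by blast
qed

text \<open>Swapping the legs keeps top and length. This reconciles arbitrary endpoints with
  \<open>vertex_pairs\<close>, where \<open>i \<le> j\<close>.\<close>

lemma trek_vec_commute:
  assumes "i \<in> pverts G" "j \<in> pverts G"
  shows "trek_vec G i j = trek_vec G j i"
proof -
  obtain p q where T: "simple_trek G (p, q)" "(p, q) \<in> treks_between G i j"
    using ex_simple_trek_between[OF assms] by auto
  have hd: "hd q = hd p"
    using T(1) by (simp add: simple_trek_def is_trek_def)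
  have "set q \<inter> set p = {hd p}"
    using T(1) by (simp add: simple_trek_def trek_top_def Int_commute)
  moreover have "(q, p) \<in> treks_between G j i"
    using T(2) hd by (simp add: treks_between_def is_trek_def)
  ultimately have "simple_trek G (q, p)"
    using hd by (simp add: treks_between_def simple_trek_def trek_top_def)
  from trek_vec_simple_trek[OF T] trek_vec_simple_trek[OF this \<open>(q, p) \<in> treks_between G j i\<close>]
  show ?thesis
    using hd by (simp add: trek_top_def trek_length_def add.commute)
qed

text \<open>Arcs are removed at the lower ends of the legs, which preserves the top and simplicity.
  All widths up to the maximal one are thus realised at the same height.\<close>

lemma shorten_simple_trek:
  assumes "simple_trek G T" "w \<le> trek_length T"
  shows "\<exists>T'. simple_trek G T' \<and> trek_top T' = trek_top T \<and> trek_length T' = w"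
proof -
  obtain p q where pq: "T = (p, q)" by (cases T)
  have T: "walk p" "walk q" "hd p = hd q" "set p \<inter> set q = {hd p}"
    using assms(1) by (auto simp: pq simple_trek_def is_trek_def dipath_iff trek_top_def)
  have ne: "p \<noteq> []" "q \<noteq> []" using T by auto
  \<comment> \<open>The first leg takes as much of \<open>w\<close> as it can, the second leg the
    rest.\<close>
  define a where "a = min (vwalk_length p) w"
  define b where "b = w - a"
  have ab: "a \<le> length p - 1" "b \<le> length q - 1" "a + b = w"
    using assms(2) by (auto simp: a_def b_def pq trek_length_def)
  define p' where "p' = take (Suc a) p"
  define q' where "q' = take (Suc b) q"
  have ne': "p' \<noteq> []" "q' \<noteq> []" using ne by (auto simp: p'_def q'_def)
  have "walk (p' @ drop (Suc a) p)" "walk (q' @ drop (Suc b) q)"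
    using T by (simp_all add: p'_def q'_def)
  then have "walk p'" "walk q'" using walk_appendD(1) ne' by blast+
  moreover have hd: "hd p' = hd p" "hd q' = hd p"
    using T(3) by (simp_all add: p'_def q'_def)
  moreover have "set p' \<inter> set q' = {hd p}"
  proof -
    have "set p' \<subseteq> set p" "set q' \<subseteq> set q" by (simp_all add: p'_def q'_def set_take_subset)
    moreover have "hd p \<in> set p'" "hd p \<in> set q'" using ne' hd hd_in_set by metis+
    ultimately show ?thesis using T(4) by blast
  qed
  moreover have "vwalk_length p' + vwalk_length q' = w"
  proof -
    have "0 < length p" "0 < length q" using ne by simp_all
    then have "Suc a \<le> length p" "Suc b \<le> length q" using ab by linarith+
    then have "length p' = Suc a" "length q' = Suc b"
      unfolding p'_def q'_def length_take by (simp_all only: min_absorb2)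
    with ab show ?thesis by simp
  qed
  ultimately show ?thesis
    by (intro exI[of _ "(p', q')"])
      (simp add: simple_trek_def is_trek_def dipath_iff trek_top_def trek_length_def pq)
qed

text \<open>Top height and length of the simple trek between two vertices stay within the bounds of
  \<open>E_hat\<close>; conversely a widest trek at height \<open>h\<close> is shortened to length
  \<open>w\<close>, and its endpoints are sorted.\<close>

lemma trek_vec_image: "(\<lambda>(i, j). trek_vec G i j) ` vertex_pairs G = E_hat G"
proof (intro subset_antisym subsetI)
  fix x assume "x \<in> (\<lambda>(i, j). trek_vec G i j) ` vertex_pairs G"
  then obtain i j where ij: "i \<in> pverts G" "j \<in> pverts G" "x = trek_vec G i j"
    by (auto simp: vertex_pairs_def)
  obtain T where T: "simple_trek G T" "T \<in> treks_between G i j"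
    using ex_simple_trek_between ij by blast
  have "walk (fst T)" using T(1) by (simp add: simple_trek_def is_trek_def dipath_iff)
  then have "trek_top T \<in> pverts G" unfolding trek_top_def by (rule walk_ends)
  then show "x \<in> E_hat G"
    using trek_vec_simple_trek[OF T] height_le_graph_height trek_length_le_width[OF T(1)] ij(3)
    unfolding E_hat_def by blast
next
  fix x assume "x \<in> E_hat G"
  then obtain h w where x: "x = ladder h w" "h \<le> graph_height G" "w \<le> trek_width G h"
    by (auto simp: E_hat_def)
  obtain T where "simple_trek G T" "height (trek_top T) = h" "w \<le> trek_length T"
    using ex_widest_trek x by metis
  then obtain T' where T': "simple_trek G T'" "height (trek_top T') = h" "trek_length T' = w"
    using shorten_simple_trek by metis
  define i where "i = last (fst T')"
  define j where "j = last (snd T')"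
  have ij: "i \<in> pverts G" "j \<in> pverts G"
    using T'(1) walk_ends(2) by (auto simp: i_def j_def simple_trek_def is_trek_def dipath_iff)
  have "T' \<in> treks_between G i j"
    using T'(1) by (simp add: treks_between_def i_def j_def simple_trek_def)
  then have "x = trek_vec G i j"
    using trek_vec_simple_trek T' x by metis
  with trek_vec_commute[OF ij] have "x = trek_vec G (min i j) (max i j)"
    by (simp add: min_def max_def)
  moreover have "(min i j, max i j) \<in> vertex_pairs G"
    using ij by (auto simp: vertex_pairs_def min_def max_def)
  ultimately show "x \<in> (\<lambda>(i, j). trek_vec G i j) ` vertex_pairs G" by force
qed

text \<open>Witnessed by the trek with one trivial leg at the ancestor of \<open>v\<close> at height
  \<open>i\<close> and the other leg descending to \<open>v\<close>.\<close>

lemma trek_width_ge: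
  assumes "v \<in> pverts G" "i \<le> height v"
  shows "height v - i \<le> trek_width G i"
proof -
  let ?T = "(drop i (rpath v), [rpath v ! i])"
  have top: "trek_top ?T = rpath v ! i"
    using walk_drop_rpath[OF assms] by (simp add: trek_top_def)
  have "rpath v ! i \<in> set (drop i (rpath v))"
    using assms length_rpath by (simp add: nth_in_drop)
  then have "simple_trek G ?T"
    using walk_drop_rpath[OF assms] rpath_nth_verts[OF assms] top
    by (auto simp: simple_trek_def is_trek_def dipath_iff vwalk_Cons_iff)
  from trek_length_le_width[OF this] show ?thesis
    unfolding top height_rpath_nth[OF assms]
    using length_rpath[OF assms(1)] by (simp add: trek_length_def)
qed

text \<open>Extending the two legs of a widest trek at height \<open>h\<close> upwards to height \<open>i\<close> gives two treks
  with top at height \<open>i\<close>, whose lengths sum to \<open>2 * (h - i) + trek_width G h\<close>.\<close>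

lemma trek_width_shift:
  assumes "i \<le> h" "h \<le> graph_height G"
  shows "2 * (h - i) + trek_width G h \<le> 2 * trek_width G i"
proof -
  obtain T where T: "simple_trek G T" "height (trek_top T) = h" "trek_length T = trek_width G h"
    using ex_widest_trek[OF assms(2)] by blast
  have w: "walk (fst T)" "walk (snd T)" "hd (fst T) = trek_top T" "hd (snd T) = trek_top T"
    using T(1) by (auto simp: simple_trek_def is_trek_def dipath_iff trek_top_def)
  let ?p = "last (fst T)" and ?q = "last (snd T)"
  have "h + vwalk_length (fst T) = height ?p" "h + vwalk_length (snd T) = height ?q"
    using vwalk_length_walk[OF w(1)] vwalk_length_walk[OF w(2)] w(3,4) T(2) by simp_all
  moreover have "vwalk_length (fst T) + vwalk_length (snd T) = trek_width G h"
    using T(3) by (simp add: trek_length_def)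
  moreover have "i \<le> height ?p \<Longrightarrow> height ?p - i \<le> trek_width G i"
    "i \<le> height ?q \<Longrightarrow> height ?q - i \<le> trek_width G i"
    using trek_width_ge walk_ends(2) w by blast+
  ultimately show ?thesis using assms(1) by linarith
qed

section \<open>The ground set and the covers of the poset\<close>

lemma poset_ground_eq:
  assumes "graph_height G > 0"
  shows "poset_ground G =
    {\<lambda>_. 0} \<union> E_hat G \<union> {ladder i w | i h w. i \<le> h \<and> ladder h w \<in> E_hat G}"
proof -
  have "poset_ground G = {coordinatewise_min X | X. X \<subseteq> E_hat G \<and> X \<noteq> {}}"
  proof (intro subset_antisym subsetI)
    fix x assume "x \<in> poset_ground G"
    then obtain S where S: "x = coordinatewise_min ((\<lambda>(i, j). trek_vec G i j) ` S)"
      "S \<subseteq> vertex_pairs G" "S \<noteq> {}"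
      unfolding poset_ground_def by blast
    then have "(\<lambda>(i, j). trek_vec G i j) ` S \<subseteq> E_hat G"
      using trek_vec_image by blast
    with S show "x \<in> {coordinatewise_min X | X. X \<subseteq> E_hat G \<and> X \<noteq> {}}" by blast
  next
    fix x assume "x \<in> {coordinatewise_min X | X. X \<subseteq> E_hat G \<and> X \<noteq> {}}"
    then obtain X where X: "x = coordinatewise_min X" "X \<subseteq> E_hat G" "X \<noteq> {}" by blast
    then obtain S where "S \<subseteq> vertex_pairs G" "X = (\<lambda>(i, j). trek_vec G i j) ` S"
      unfolding trek_vec_image[symmetric] subset_image_iff by blast
    with X show "x \<in> poset_ground G" unfolding poset_ground_def by blast
  qed
  also have "\<dots> = {\<lambda>_. 0} \<union> E_hat G \<union> {ladder i w | i h w. i \<le> h \<and> ladder h w \<in> E_hat G}"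
  proof (rule coordinatewise_min_ladders[where H = "graph_height G" and W = "trek_width G"])
    \<comment> \<open>The width inequality between heights 0 and \<open>graph_height G\<close>
      bounds \<open>trek_width G 0\<close> below by \<open>graph_height G\<close>.\<close>
    show "0 < trek_width G 0" using trek_width_shift[of 0 "graph_height G"] assms by simp
    \<comment> \<open>If \<open>trek_width G i < w\<close>, then \<open>2 * (h - i)\<close> is at
      most \<open>2 * trek_width G i - trek_width G h\<close>, which is less than
      \<open>2 * w - w\<close>.\<close>
    show "w \<le> trek_width G i \<or> 2 * (h - i) \<le> w"
      if "i \<le> h" "h \<le> graph_height G" "w \<le> trek_width G h" for i h w
      using trek_width_shift[OF that(1,2)] that(3) by linarith
  qed (simp add: E_hat_def)
  finally show ?thesis .
qed

end

theorem theorem4p13: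
  fixes m :: nat and G :: "nat pair_pre_digraph"
  assumes "pverts G = {1..m}"
    and "directed_tree G"
    and "graph_height G > 0"
  shows "poset_ground G =
           {\<lambda>_. 0} \<union> E_hat G \<union> {ladder i w | i h w. i \<le> h \<and> ladder h w \<in> E_hat G}
       \<and> covering_relations (poset_ground G) =
           {(\<lambda>_. 0, ladder 0 w) | w. ladder 0 w \<in> poset_ground G}
         \<union> {(ladder (h - 1) w, ladder h w) | h w. ladder h w \<in> poset_ground G \<and> h \<ge> 1}
         \<union> {(ladder (h - i) (w + 2 * i), ladder h w) | h w i.
              ladder h w \<in> poset_ground G \<and> 0 < i \<and> i \<le> h
              \<and> ladder (h - i) (w + 2 * i) \<in> poset_ground G
              \<and> (\<forall>j. 0 < j \<and> j < i \<longrightarrow> ladder (h - j) (w + 2 * j) \<notin> poset_ground G)}"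
proof
  interpret dir_tree G using assms(2) by unfold_locales
  show ground: "poset_ground G =
      {\<lambda>_. 0} \<union> E_hat G \<union> {ladder i w | i h w. i \<le> h \<and> ladder h w \<in> E_hat G}"
    by (rule poset_ground_eq[OF assms(3)])
  \<comment> \<open>All truncations are recorded, so \<open>L\<close> is closed under shortening;
    \<open>E_hat G\<close> itself is absorbed as the case \<open>i = h\<close>.\<close>
  define L where "L = {(i, w). \<exists>h\<ge>i. ladder h w \<in> E_hat G}"
  have "E_hat G \<subseteq> {ladder i w | i h w. i \<le> h \<and> ladder h w \<in> E_hat G}"
    unfolding E_hat_def by blast
  then have "poset_ground G = insert (\<lambda>_. 0) {ladder h w | h w. (h, w) \<in> L}"
    unfolding ground L_def by blast
  then show "covering_relations (poset_ground G) =
           {(\<lambda>_. 0, ladder 0 w) | w. ladder 0 w \<in> poset_ground G}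
         \<union> {(ladder (h - 1) w, ladder h w) | h w. ladder h w \<in> poset_ground G \<and> h \<ge> 1}
         \<union> {(ladder (h - i) (w + 2 * i), ladder h w) | h w i.
              ladder h w \<in> poset_ground G \<and> 0 < i \<and> i \<le> h
              \<and> ladder (h - i) (w + 2 * i) \<in> poset_ground G
              \<and> (\<forall>j. 0 < j \<and> j < i \<longrightarrow> ladder (h - j) (w + 2 * j) \<notin> poset_ground G)}"
    by (rule covering_relations_ladders) (use order_trans in \<open>auto simp: L_def\<close>)
qed

end
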